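(* Let $c_1,c_2\in\mathbb{R}$ with $c_1>|c_2|$, and set $$a=\frac{1}{\sqrt2}\left(\sqrt{c_1+c_2}+\sqrt{c_1-c_2}\right),\qquad b=\frac{1}{\sqrt2}\left(\sqrt{c_1+c_2}-\sqrt{c_1-c_2}\right).$$ Then: (i) $\mathfrak{t}_1\cap\operatorname{Orb}_{c_1;c_2}=\{M^1_{a,b},\,M^1_{-a,-b},\,M^1_{b,a},\,M^1_{-b,-a}\}$; (ii) $\mathfrak{t}_2\cap\operatorname{Orb}_{c_1;c_2}=\{M^2_{a,b},\,M^2_{-a,-b},\,M^2_{b,a},\,M^2_{-b,-a}\}$; (iii) $\mathfrak{t}_3\cap\operatorname{Orb}_{c_1;c_2}=\{M^3_{a,b},\,M^3_{-a,-b},\,M^3_{b,a},\,M^3_{-b,-a}\}$.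
   Context: Write elements of $\mathfrak{so}(4)$ (real antisymmetric $4\times4$ matrices) as $$M=\begin{bmatrix}0&-x_3&x_2&y_1\\ x_3&0&-x_1&y_2\\ -x_2&x_1&0&y_3\\ -y_1&-y_2&-y_3&0\end{bmatrix},\qquad x_i,y_i\in\mathbb{R}.$$ Let $C_1(M)=\frac12\left(\sum_{i=1}^3x_i^2+\sum_{i=1}^3y_i^2\right)$ and $C_2(M)=\sum_{i=1}^3x_iy_i$. For $c_1>|c_2|$ let $\operatorname{Orb}_{c_1;c_2}=\{M\in\mathfrak{so}(4)\mid C_1(M)=c_1,\ C_2(M)=c_2\}$, a regular adjoint orbit of $\operatorname{SO}(4)$. For $i\in\{1,2,3\}$ and $p,q\in\mathbb{R}$ let $M^i_{p,q}$ be the matrix with $x_i=p$, $y_i=q$ and all other coordinates $x_j,y_j$ ($j\ne i$) equal to $0$, and let $\mathfrak{t}_i=\{M^i_{p,q}\mid p,q\in\mathbb{R}\}$. These are the Cartan subalgebras of $\mathfrak{so}(4)$ called of coordinate type. *)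

theory Defs
  imports "HOL-Analysis.Analysis"
begin

definition so4 :: "(real^4^4) set" where
  "so4 = {M. transpose M = - M}"

definition so4_mat :: "real^3 \<Rightarrow> real^3 \<Rightarrow> real^4^4" where
  "so4_mat x y = vector
     [vector [       0, - (x $ 3),    x $ 2,  y $ 1],
      vector [   x $ 3,         0, - (x $ 1), y $ 2],
      vector [- (x $ 2),    x $ 1,        0,  y $ 3],
      vector [- (y $ 1), - (y $ 2), - (y $ 3), 0]]"

text \<open>The coordinates of a matrix are read off its entries; on \<open>so4\<close> these maps are
  inverse to \<open>so4_mat\<close> (lemmas below).\<close>

definition so4_x :: "real^4^4 \<Rightarrow> real^3" where
  "so4_x M = vector [M $ 3 $ 2, M $ 1 $ 3, M $ 2 $ 1]"

definition so4_y :: "real^4^4 \<Rightarrow> real^3" where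
  "so4_y M = vector [M $ 1 $ 4, M $ 2 $ 4, M $ 3 $ 4]"

definition C1 :: "real^4^4 \<Rightarrow> real" where
  "C1 M = 1/2 * ((\<Sum>i\<in>UNIV. (so4_x M $ i)\<^sup>2) + (\<Sum>i\<in>UNIV. (so4_y M $ i)\<^sup>2))"

definition C2 :: "real^4^4 \<Rightarrow> real" where
  "C2 M = (\<Sum>i\<in>UNIV. so4_x M $ i * so4_y M $ i)"

definition Orb :: "real \<Rightarrow> real \<Rightarrow> (real^4^4) set" where
  "Orb c1 c2 = {M \<in> so4. C1 M = c1 \<and> C2 M = c2}"

definition coord_mat :: "3 \<Rightarrow> real \<Rightarrow> real \<Rightarrow> real^4^4" where
  "coord_mat i p q = so4_mat (axis i p) (axis i q)"

definition cartan_coord :: "3 \<Rightarrow> (real^4^4) set" where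
  "cartan_coord i = {coord_mat i p q | p q. True}"

lemma vector_4_nth:
  fixes a b c d :: "'a::zero"
  shows "(vector [a, b, c, d] :: 'a^4) $ 1 = a"
    and "(vector [a, b, c, d] :: 'a^4) $ 2 = b"
    and "(vector [a, b, c, d] :: 'a^4) $ 3 = c"
    and "(vector [a, b, c, d] :: 'a^4) $ 4 = d"
  by (simp_all add: vector_def)

lemma so4_x_so4_mat [simp]: "so4_x (so4_mat x y) = x"
  by (simp add: so4_x_def so4_mat_def vec_eq_iff forall_3 vector_4_nth)

lemma so4_y_so4_mat [simp]: "so4_y (so4_mat x y) = y"
  by (simp add: so4_y_def so4_mat_def vec_eq_iff forall_3 vector_4_nth)

lemma so4_mat_in_so4 [simp]: "so4_mat x y \<in> so4"
  by (simp add: so4_def so4_mat_def transpose_def vec_eq_iff forall_4 vector_4_nth)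

lemma so4_mat_so4_x_so4_y:
  assumes "M \<in> so4"
  shows "so4_mat (so4_x M) (so4_y M) = M"
proof -
  have skew: "M $ j $ i = - (M $ i $ j)" for i j
  proof -
    have "M $ j $ i = transpose M $ i $ j"
      by (simp add: transpose_def)
    also have "transpose M = - M"
      using assms by (simp only: so4_def mem_Collect_eq)
    finally show ?thesis
      by simp
  qed
  have diag: "M $ i $ i = 0" for i
    using skew[of i i] by linarith
  show ?thesis
    by (simp add: so4_x_def so4_y_def so4_mat_def vec_eq_iff forall_4 vector_4_nth diag
        skew[of 1 2] skew[of 3 1] skew[of 2 3] skew[of 1 4] skew[of 2 4] skew[of 3 4])
qed

end

theory Submission
  imports Defs
begin

text \<open>On a coordinate Cartan subalgebra the two invariants restrict to
  \<open>C1 = (p\<^sup>2 + q\<^sup>2) / 2\<close> and \<open>C2 = p q\<close>, whichever of the three indices is used. The intersection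
  with the orbit is therefore a circle cut by a hyperbola (by the two axes if \<open>c2 = 0\<close>). In the rotated coordinates \<open>p + q\<close>,
  \<open>p - q\<close> the system decouples into
  \<open>(p + q)\<^sup>2 = 2 (c1 + c2)\<close> and \<open>(p - q)\<^sup>2 = 2 (c1 - c2)\<close>,
  so that its solutions are given by two independent choices of sign. The numbers \<open>a\<close> and \<open>b\<close> are
  the solution with both signs positive; the other choices give \<open>(b, a)\<close>, \<open>(-b, -a)\<close>
  and \<open>(-a, -b)\<close>.\<close>

lemma coord_mat_in_Orb_iff:
  "coord_mat i p q \<in> Orb c1 c2 \<longleftrightarrow> p\<^sup>2 + q\<^sup>2 = 2 * c1 \<and> p * q = c2"
proof -
  have sq: "(\<Sum>j\<in>UNIV. (axis i r $ j)\<^sup>2) = r\<^sup>2" for r :: real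
    by (simp add: axis_def if_distrib [of "\<lambda>z. z\<^sup>2"] cong: if_cong)
  have "(\<Sum>j\<in>UNIV. axis i p $ j * axis i q $ j) = p * q"
    by (simp add: axis_def if_distrib [of "\<lambda>z. z * _"] cong: if_cong)
  with sq show ?thesis
    by (auto simp: coord_mat_def Orb_def C1_def C2_def)
qed

text \<open>The sums \<open>p + q\<close> and \<open>a + b\<close> have equal squares, and so do the differences, which
  leaves a sign for each; the four sign patterns are the four solutions.\<close>

lemma sum_squares_and_product_eq_iff:
  fixes p q a b :: real
  shows "p\<^sup>2 + q\<^sup>2 = a\<^sup>2 + b\<^sup>2 \<and> p * q = a * b \<longleftrightarrow>
    (p, q) \<in> {(a, b), (-a, -b), (b, a), (-b, -a)}"
proof
  assume *: "p\<^sup>2 + q\<^sup>2 = a\<^sup>2 + b\<^sup>2 \<and> p * q = a * b"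
  have "(p + q)\<^sup>2 = (a + b)\<^sup>2" and "(p - q)\<^sup>2 = (a - b)\<^sup>2"
    using * by (simp_all add: power2_sum power2_diff)
  then have "p + q = a + b \<or> p + q = - (a + b)" and "p - q = a - b \<or> p - q = - (a - b)"
    by (simp_all only: power2_eq_iff)
  then show "(p, q) \<in> {(a, b), (-a, -b), (b, a), (-b, -a)}"
    by auto
qed (auto simp: mult.commute)

lemma cartan_coord_Int_Orb:
  assumes "a\<^sup>2 + b\<^sup>2 = 2 * c1" and "a * b = c2"
  shows "cartan_coord i \<inter> Orb c1 c2 =
    {coord_mat i a b, coord_mat i (-a) (-b), coord_mat i b a, coord_mat i (-b) (-a)}"
proof -
  have "coord_mat i p q \<in> Orb c1 c2 \<longleftrightarrow> (p, q) \<in> {(a, b), (-a, -b), (b, a), (-b, -a)}" for p q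
    using sum_squares_and_product_eq_iff [of p q a b] by (simp add: coord_mat_in_Orb_iff assms)
  then show ?thesis
    by (auto simp: cartan_coord_def)
qed

theorem theorem3p2:
  fixes c1 c2 a b :: real
  assumes "c1 > \<bar>c2\<bar>"
    and "a = 1 / sqrt 2 * (sqrt (c1 + c2) + sqrt (c1 - c2))"
    and "b = 1 / sqrt 2 * (sqrt (c1 + c2) - sqrt (c1 - c2))"
  shows "cartan_coord 1 \<inter> Orb c1 c2 =
           {coord_mat 1 a b, coord_mat 1 (-a) (-b), coord_mat 1 b a, coord_mat 1 (-b) (-a)}
       \<and> cartan_coord 2 \<inter> Orb c1 c2 =
           {coord_mat 2 a b, coord_mat 2 (-a) (-b), coord_mat 2 b a, coord_mat 2 (-b) (-a)}
       \<and> cartan_coord 3 \<inter> Orb c1 c2 =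
           {coord_mat 3 a b, coord_mat 3 (-a) (-b), coord_mat 3 b a, coord_mat 3 (-b) (-a)}"
proof -
  define s where "s = sqrt (c1 + c2)"
  define t where "t = sqrt (c1 - c2)"
  have s: "s\<^sup>2 = c1 + c2" and t: "t\<^sup>2 = c1 - c2"
    using assms(1) by (simp_all add: s_def t_def)
  have a: "a = (s + t) / sqrt 2" and b: "b = (s - t) / sqrt 2"
    by (simp_all add: assms(2,3) s_def t_def)
  have "a\<^sup>2 + b\<^sup>2 = s\<^sup>2 + t\<^sup>2"
    by (simp add: a b power_divide power2_sum power2_diff field_simps)
  then have "a\<^sup>2 + b\<^sup>2 = 2 * c1"
    by (simp add: s t)
  moreover have "a * b = (s\<^sup>2 - t\<^sup>2) / 2"
    by (simp add: a b power2_eq_square algebra_simps)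
  then have "a * b = c2"
    by (simp add: s t)
  ultimately show ?thesis
    by (simp add: cartan_coord_Int_Orb)
qed

end
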